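(* Let $m\ge0$, $n=m+3$, and let $\mathcal F=(W_{i,j})$ be a closed decorated frieze of width $m$. Then $$W_{i,j}=W_{j,i+n}$$ for every $i,j\in\mathbb Z$ with $0\le j-i\le n$. Equivalently, the index transformation $G(i,j)=(j,i+n)$ leaves the decorated frieze invariant.
   Context: Fix an integer $m\ge 0$ and put $n=m+3$. Let $x_1,\dots,x_m,y_1,\dots,y_n$ be algebraically independent variables, extend $y_{i+n}=y_i$ for $i\in\mathbb Z$, and put $\mathscr R_m=\mathbb Z[x_1^{\pm1},\dots,x_m^{\pm1},y_1^{\pm1},\dots,y_n^{\pm1}]$. A closed decorated frieze of width $m$ is a family $\mathcal F=(W_{i,j})$ of elements of $\mathscr R_m$, indexed by $i,j\in\mathbb Z$ with $0\le j-i\le n$, such that: (D1) $W_{i,i}=0$ and $W_{i,i+n}=0$ for all $i$; (D2) $W_{i,i+1}=y_i$ and $W_{i,i+n-1}=y_{i-1}$ for all $i$; (D3) every interior entry, i.e. every $W_{i,j}$ with $2\le j-i\le n-2$, is nonzero; (D4) for all $i,j$ with $1\le j-i\le n-1$, $W_{i,j}W_{i+1,j+1}-W_{i+1,j}W_{i,j+1}=y_iy_j$. No periodicity of the entries is assumed. *)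

theory Defs
  imports Complex_Main "HOL-Library.Poly_Mapping"
begin

text \<open>
  An exponent vector is a finitely supported map from variable indices to the integers. With the
  convolution product of \<^theory>\<open>HOL-Library.Poly_Mapping\<close>, the finitely supported integer
  functions on exponent vectors are the Laurent polynomials over the integers in the variables
  indexed by the natural numbers.
\<close>

type_synonym laurent = "(nat \<Rightarrow>\<^sub>0 int) \<Rightarrow>\<^sub>0 int"

definition lvar_pow :: "nat \<Rightarrow> int \<Rightarrow> laurent" where
  "lvar_pow k a = Poly_Mapping.single (Poly_Mapping.single k a) 1"

abbreviation lvar :: "nat \<Rightarrow> laurent" where
  "lvar k \<equiv> lvar_pow k 1"

abbreviation frieze_n :: "nat \<Rightarrow> nat" where
  "frieze_n m \<equiv> m + 3"

text \<open>
  The variables of index \<open>1, \<dots>, m\<close> are \<open>x\<^sub>1, \<dots>, x\<^sub>m\<close>, and those of index \<open>m + 1, \<dots>, m + n\<close> are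
  \<open>y\<^sub>1, \<dots>, y\<^sub>n\<close>.
\<close>

definition laurent_ring :: "nat \<Rightarrow> laurent set" where
  "laurent_ring m =
    {f. \<forall>e \<in> Poly_Mapping.keys f. Poly_Mapping.keys e \<subseteq> {1..m + frieze_n m}}"

text \<open>The \<open>n\<close>-periodic extension of \<open>y\<^sub>1, \<dots>, y\<^sub>n\<close> to all integer indices.\<close>

definition yvar :: "nat \<Rightarrow> int \<Rightarrow> laurent" where
  "yvar m i = lvar (m + 1 + nat ((i - 1) mod int (frieze_n m)))"

lemma yvar_eq_lvar:
  assumes "1 \<le> k" "k \<le> frieze_n m"
  shows "yvar m (int k) = lvar (m + k)"
proof -
  have "(int k - 1) mod int (frieze_n m) = int k - 1"
    using assms by (intro mod_pos_pos_trivial) auto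
  then have "m + 1 + nat ((int k - 1) mod int (frieze_n m)) = m + k"
    using assms by simp
  then show ?thesis by (simp only: yvar_def)
qed

lemma yvar_periodic: "yvar m (i + int (frieze_n m)) = yvar m i"
proof -
  have "(i + int (frieze_n m) - 1) mod int (frieze_n m) = (i - 1) mod int (frieze_n m)"
    by (metis add.commute add_diff_eq mod_add_self1)
  then show ?thesis by (simp only: yvar_def)
qed

lemma lvar_pow_in_laurent_ring:
  "k \<in> {1..m + frieze_n m} \<Longrightarrow> lvar_pow k a \<in> laurent_ring m"
  by (simp add: laurent_ring_def lvar_pow_def)

lemma lvar_pow_add: "lvar_pow k a * lvar_pow k b = lvar_pow k (a + b)"
  by (simp add: lvar_pow_def mult_single single_add)

lemma lvar_pow_0: "lvar_pow k 0 = 1"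
  by (simp add: lvar_pow_def)

lemma laurent_ring_closed:
  assumes "f \<in> laurent_ring m" "g \<in> laurent_ring m"
  shows "f + g \<in> laurent_ring m" "f - g \<in> laurent_ring m" "f * g \<in> laurent_ring m"
proof -
  show "f + g \<in> laurent_ring m" "f - g \<in> laurent_ring m"
    using assms keys_add[of f g] keys_diff[of f g] unfolding laurent_ring_def by blast+
  show "f * g \<in> laurent_ring m"
    unfolding laurent_ring_def
  proof safe
    fix e k assume "e \<in> Poly_Mapping.keys (f * g)" and k: "k \<in> Poly_Mapping.keys e"
    then obtain a b where e: "e = a + b" "a \<in> Poly_Mapping.keys f" "b \<in> Poly_Mapping.keys g"
      using keys_mult[of f g] by blast
    then have "k \<in> Poly_Mapping.keys a \<union> Poly_Mapping.keys b"
      using k keys_add[of a b] by blast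
    then show "k \<in> {1..m + frieze_n m}"
      using e assms unfolding laurent_ring_def by blast
  qed
qed

definition frieze_band :: "nat \<Rightarrow> (int \<times> int) set" where
  "frieze_band m = {(i, j). 0 \<le> j - i \<and> j - i \<le> int (frieze_n m)}"

text \<open>
  A frieze is a family indexed by \<^const>\<open>frieze_band\<close>; the values of \<open>W\<close> outside the band are
  arbitrary and occur in none of the conditions.
\<close>

definition closed_decorated_frieze :: "nat \<Rightarrow> (int \<Rightarrow> int \<Rightarrow> laurent) \<Rightarrow> bool" where
  "closed_decorated_frieze m W \<longleftrightarrow>
    (let n = int (frieze_n m); y = yvar m in
      (\<forall>(i, j) \<in> frieze_band m. W i j \<in> laurent_ring m) \<and>
      (\<forall>i. W i i = 0 \<and> W i (i + n) = 0) \<and>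
      (\<forall>i. W i (i + 1) = y i \<and> W i (i + n - 1) = y (i - 1)) \<and>
      (\<forall>i j. 2 \<le> j - i \<and> j - i \<le> n - 2 \<longrightarrow> W i j \<noteq> 0) \<and>
      (\<forall>i j. 1 \<le> j - i \<and> j - i \<le> n - 1 \<longrightarrow>
        W i j * W (i + 1) (j + 1) - W (i + 1) j * W i (j + 1) = y i * y j))"

definition glide :: "nat \<Rightarrow> int \<times> int \<Rightarrow> int \<times> int" where
  "glide m = (\<lambda>(i, j). (j, i + int (frieze_n m)))"

end

theory Submission
  imports Defs
begin

text \<open>
  Neighbouring rows have Wronskian-like minors, so all rows satisfy one and the same three-term
  recurrence in the column index; by reflection \<open>(i, j) \<mapsto> (- j, - i)\<close> all columns satisfy a three-term
  recurrence in the row index. In both cases the coefficient at position \<open>j\<close> can be read off the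
  second off-diagonal: it is \<open>W (j - 1) (j + 1)\<close>. Row \<open>i\<close> and column \<open>i + n\<close> hence solve the same
  recurrence, and they have the same two initial values \<open>0\<close> and \<open>y i\<close>.
\<close>

lemma frieze_row_recurrence:
  fixes W :: "int \<Rightarrow> int \<Rightarrow> 'a :: idom"
  assumes diag: "\<And>i. W i i = 0" and super: "\<And>i. W i (i + 1) = y i"
    and nz: "\<And>i j. 1 \<le> j - i \<Longrightarrow> j - i \<le> n - 1 \<Longrightarrow> W i j \<noteq> 0"
    and rule: "\<And>i j. 1 \<le> j - i \<Longrightarrow> j - i \<le> n - 1 \<Longrightarrow>
        W i j * W (i + 1) (j + 1) - W (i + 1) j * W i (j + 1) = y i * y j"
    and "i \<le> j - 1" "j - i \<le> n - 1"
  shows "y (j - 1) * W i (j + 1) + y j * W i (j - 1) = W (j - 1) (j + 1) * W i j"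
  using assms(5,6)
proof (induction i rule: int_le_induct)
  case base
  \<comment> \<open>In row \<open>j - 1\<close> the entry at \<open>j - 1\<close> vanishes and the
    entry at \<open>j\<close> is \<open>y (j - 1)\<close>, which fixes the coefficient.\<close>
  then show ?case using super[of "j - 1"] diag[of "j - 1"] by (simp add: mult.commute)
next
  case (step i)
  then have IH: "y (j - 1) * W i (j + 1) + y j * W i (j - 1) = W (j - 1) (j + 1) * W i j"
    by simp
  have "W (i - 1) j * W i (j + 1) - W i j * W (i - 1) (j + 1) = y (i - 1) * y j"
    using rule[of j "i - 1"] step by simp
  moreover have "W (i - 1) (j - 1) * W i j - W i (j - 1) * W (i - 1) j = y (i - 1) * y (j - 1)"
    using rule[of "j - 1" "i - 1"] step by simp
  \<comment> \<open>Weighted by \<open>y (j - 1)\<close> and \<open>y j\<close>, the two minors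
    agree. Hence the left side equals \<open>W (i - 1) j\<close> times the left side of
    \<open>IH\<close>; afterwards \<open>W i j\<close> cancels.\<close>
  ultimately have "W i j * (y (j - 1) * W (i - 1) (j + 1) + y j * W (i - 1) (j - 1))
      = W i j * (W (j - 1) (j + 1) * W (i - 1) j)"
    using IH by algebra
  moreover have "W i j \<noteq> 0" using nz step by simp
  ultimately show ?case by simp
qed

lemma frieze_column_recurrence:
  fixes W :: "int \<Rightarrow> int \<Rightarrow> 'a :: idom"
  assumes diag: "\<And>i. W i i = 0" and super: "\<And>i. W i (i + 1) = y i"
    and nz: "\<And>i j. 1 \<le> j - i \<Longrightarrow> j - i \<le> n - 1 \<Longrightarrow> W i j \<noteq> 0"
    and rule: "\<And>i j. 1 \<le> j - i \<Longrightarrow> j - i \<le> n - 1 \<Longrightarrow>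
        W i j * W (i + 1) (j + 1) - W (i + 1) j * W i (j + 1) = y i * y j"
    and "j + 1 \<le> k" "k - j \<le> n - 1"
  shows "y (j - 1) * W (j + 1) k + y j * W (j - 1) k = W (j - 1) (j + 1) * W j k"
proof -
  define V where "V = (\<lambda>i j. W (- j) (- i))"
  \<comment> \<open>A superdiagonal entry is labelled by its smaller index, and reflection exchanges
    the two indices: hence the shift by one.\<close>
  define z where "z = (\<lambda>i. y (- i - 1))"
  \<comment> \<open>Reflection sends (j - 1, j + 1) to (- j - 1, - j + 1), so the coefficient is the
    same as for rows.\<close>
  have "z (- j - 1) * V (- k) (- j + 1) + z (- j) * V (- k) (- j - 1)
      = V (- j - 1) (- j + 1) * V (- k) (- j)"
  proof (rule frieze_row_recurrence[where n = n])
    show "V i i = 0" for i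
      by (simp add: V_def diag)
    show "V i (i + 1) = z i" for i
      using super[of "- i - 1"] by (simp add: V_def z_def)
    show "V i j \<noteq> 0" if "1 \<le> j - i" "j - i \<le> n - 1" for i j
      using nz[of "- i" "- j"] that by (simp add: V_def)
    show "V i j * V (i + 1) (j + 1) - V (i + 1) j * V i (j + 1) = z i * z j"
      if "1 \<le> j - i" "j - i \<le> n - 1" for i j
      using rule[of "- i - 1" "- j - 1"] that by (simp add: V_def z_def mult.commute)
  qed (use assms(5,6) in auto)
  then show ?thesis by (simp add: V_def z_def algebra_simps)
qed

lemma frieze_glide_symmetric:
  fixes W :: "int \<Rightarrow> int \<Rightarrow> 'a :: idom"
  assumes diag: "\<And>i. W i i = 0" "\<And>i. W i (i + n) = 0"
    and super: "\<And>i. W i (i + 1) = y i" "\<And>i. W i (i + n - 1) = y (i - 1)"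
    and nz: "\<And>i j. 1 \<le> j - i \<Longrightarrow> j - i \<le> n - 1 \<Longrightarrow> W i j \<noteq> 0"
    and rule: "\<And>i j. 1 \<le> j - i \<Longrightarrow> j - i \<le> n - 1 \<Longrightarrow>
        W i j * W (i + 1) (j + 1) - W (i + 1) j * W i (j + 1) = y i * y j"
    and ynz: "\<And>i. y i \<noteq> 0"
    and "0 \<le> j - i" "j - i \<le> n"
  shows "W i j = W j (i + n)"
proof -
  \<comment> \<open>A second-order recurrence needs two consecutive equalities as induction
    hypothesis; the guard keeps both inside the band.\<close>
  have two: "j + 1 \<le> i + n \<longrightarrow> W i j = W j (i + n) \<and> W i (j + 1) = W (j + 1) (i + n)"
    if "i \<le> j" for j
    using that
  proof (induction j rule: int_ge_induct)
    case base
    \<comment> \<open>The closing condition for row \<open>i + 1\<close> gives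
      \<open>W (i + 1) (i + n) = y i\<close>.\<close>
    show ?case using diag super(1)[of i] super(2)[of "i + 1"] by (simp add: algebra_simps)
  next
    case (step j)
    show ?case
    proof
      assume le: "j + 1 + 1 \<le> i + n"
      then have IH: "W i j = W j (i + n)" "W i (j + 1) = W (j + 1) (i + n)"
        using step by auto
      have "y j * W i (j + 2) + y (j + 1) * W i j = W j (j + 2) * W i (j + 1)"
        using frieze_row_recurrence[of W y n i "j + 1", OF diag(1) super(1) nz rule] step le
        by (simp add: add.commute)
      moreover have "y j * W (j + 2) (i + n) + y (j + 1) * W j (i + n)
          = W j (j + 2) * W (j + 1) (i + n)"
        using frieze_column_recurrence[of W y n "j + 1" "i + n", OF diag(1) super(1) nz rule]
          step le
        by (simp add: add.commute)
      ultimately have "y j * W i (j + 2) = y j * W (j + 2) (i + n)"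
        using IH by (metis add_right_cancel)
      then show "W i (j + 1) = W (j + 1) (i + n) \<and> W i (j + 1 + 1) = W (j + 1 + 1) (i + n)"
        using IH ynz[of j] by (simp add: add.assoc)
    qed
  qed
  show ?thesis
  proof (cases "j = i + n")
    \<comment> \<open>The guard of \<open>two\<close> excludes this end of the band, where both
      sides are zero.\<close>
    case True
    then show ?thesis using diag by simp
  next
    case False
    then show ?thesis using two[of j] assms by simp
  qed
qed

theorem theorem2p10:
  fixes m :: nat and W :: "int \<Rightarrow> int \<Rightarrow> laurent"
  assumes "closed_decorated_frieze m W"
  shows "(\<forall>i j. 0 \<le> j - i \<and> j - i \<le> int (frieze_n m) \<longrightarrow> W i j = W j (i + int (frieze_n m))) \<and>
    (\<forall>p \<in> frieze_band m. glide m p \<in> frieze_band m \<and> case_prod W (glide m p) = case_prod W p)"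
proof -
  define n where "n = int (frieze_n m)"
  have diag: "\<And>i. W i i = 0" "\<And>i. W i (i + n) = 0"
    and super: "\<And>i. W i (i + 1) = yvar m i" "\<And>i. W i (i + n - 1) = yvar m (i - 1)"
    and interior: "\<And>i j. 2 \<le> j - i \<Longrightarrow> j - i \<le> n - 2 \<Longrightarrow> W i j \<noteq> 0"
    and rule: "\<And>i j. 1 \<le> j - i \<Longrightarrow> j - i \<le> n - 1 \<Longrightarrow>
        W i j * W (i + 1) (j + 1) - W (i + 1) j * W i (j + 1) = yvar m i * yvar m j"
    using assms unfolding closed_decorated_frieze_def Let_def n_def by blast+
  have ynz: "yvar m i \<noteq> 0" for i
    by (simp add: yvar_def lvar_pow_def)
  have nz: "W i j \<noteq> 0" if ij: "1 \<le> j - i" "j - i \<le> n - 1" for i j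
  proof -
    \<comment> \<open>Outside the interior the entries are variables, hence nonzero.\<close>
    have "j = i + 1 \<or> j = i + n - 1 \<or> 2 \<le> j - i \<and> j - i \<le> n - 2"
      using ij by linarith
    then show ?thesis using super interior ynz by metis
  qed
  have sym: "W i j = W j (i + n)" if "0 \<le> j - i" "j - i \<le> n" for i j
    using frieze_glide_symmetric[of W n "yvar m", OF diag super nz rule ynz that] .
  have "glide m p \<in> frieze_band m \<and> case_prod W (glide m p) = case_prod W p"
    if "p \<in> frieze_band m" for p
  proof -
    obtain i j where p: "p = (i, j)" by (cases p)
    have "0 \<le> j - i" "j - i \<le> n"
      using that p by (simp_all add: frieze_band_def n_def)
    then show ?thesis
      using sym[of j i] by (simp add: p frieze_band_def glide_def n_def)
  qed
  then show ?thesis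
    using sym unfolding n_def by blast
qed

end
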